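(* Let $X$ be a topological space. (1) $X$ is almost Scheepers if and only if for each sequence $(N_n)_{n\in\mathbb{N}}$ of neighbourhood assignments of $X$ there exists a sequence $(F_n)_{n\in\mathbb{N}}$ of finite subsets of $X$ such that every finite set $F\subseteq X$ is contained in $\overline{N_n(F_n)}$ for some $n$. (2) $X$ is weakly Scheepers (in the sense of Sakai) if and only if for each sequence $(N_n)$ of neighbourhood assignments of $X$ there exists a sequence $(F_n)$ of finite subsets of $X$ such that for every finite collection $\mathcal{F}$ of nonempty open subsets of $X$ there is an $n$ with $U\cap N_n(F_n)\neq\emptyset$ for all $U\in\mathcal{F}$. (3) $X$ is weakly Scheepers in the sense of Kočinac if and only if for each sequence $(N_n)$ of neighbourhood assignments of $X$ there exist a sequence $(F_n)$ of finite subsets of $X$ and a dense set $Y\subseteq X$ such that every finite set $F\subseteq Y$ is contained in $N_n(F_n)$ for some $n$.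
   Context: A neighbourhood assignment for a space $(X,\tau)$ is a function $N:X\to\tau$ with $x\in N(x)$ for each $x\in X$; for $F\subseteq X$, $N(F)=\bigcup_{x\in F}N(x)$. In each item below the condition is required for every sequence $(\mathcal{U}_n)_{n\in\mathbb{N}}$ of open covers of $X$. $X$ is almost Scheepers if there are finite $\mathcal{V}_n\subseteq\mathcal{U}_n$ such that every finite set $F\subseteq X$ is contained in $\overline{\bigcup\mathcal{V}_n}$ for some $n$. $X$ is weakly Scheepers (in the sense of Sakai) if there are finite $\mathcal{V}_n\subseteq\mathcal{U}_n$ such that for every finite collection $\mathcal{F}$ of nonempty open subsets of $X$ there is an $n$ with $U\cap\left(\bigcup\mathcal{V}_n\right)\neq\emptyset$ for all $U\in\mathcal{F}$. $X$ is weakly Scheepers in the sense of Kočinac if there are a dense set $Y\subseteq X$ and finite $\mathcal{V}_n\subseteq\mathcal{U}_n$ such that every finite set $F\subseteq Y$ is contained in $\bigcup\mathcal{V}_n$ for some $n$. *)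

theory Defs
  imports "HOL-Analysis.Analysis"
begin

definition open_cover :: "'a topology \<Rightarrow> 'a set set \<Rightarrow> bool" where
  "open_cover X \<U> \<longleftrightarrow> (\<forall>U\<in>\<U>. openin X U) \<and> \<Union>\<U> = topspace X"

text \<open>The values of an assignment outside \<^term>\<open>topspace X\<close> are unconstrained;
  assignments are only ever applied to subsets of \<^term>\<open>topspace X\<close>.\<close>

definition nbhd_assignment :: "'a topology \<Rightarrow> ('a \<Rightarrow> 'a set) \<Rightarrow> bool" where
  "nbhd_assignment X N \<longleftrightarrow> (\<forall>x\<in>topspace X. openin X (N x) \<and> x \<in> N x)"

definition nbhd_of_set :: "('a \<Rightarrow> 'a set) \<Rightarrow> 'a set \<Rightarrow> 'a set" where
  "nbhd_of_set N F = (\<Union>x\<in>F. N x)"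

definition dense_set :: "'a topology \<Rightarrow> 'a set \<Rightarrow> bool" where
  "dense_set X Y \<longleftrightarrow> Y \<subseteq> topspace X \<and> X closure_of Y = topspace X"

definition almost_Scheepers :: "'a topology \<Rightarrow> bool" where
  "almost_Scheepers X \<longleftrightarrow>
    (\<forall>\<U> :: nat \<Rightarrow> 'a set set. (\<forall>n. open_cover X (\<U> n)) \<longrightarrow>
      (\<exists>\<V> :: nat \<Rightarrow> 'a set set. (\<forall>n. finite (\<V> n) \<and> \<V> n \<subseteq> \<U> n) \<and>
        (\<forall>F. finite F \<and> F \<subseteq> topspace X \<longrightarrow> (\<exists>n. F \<subseteq> X closure_of (\<Union>(\<V> n))))))"

definition weakly_Scheepers_Sakai :: "'a topology \<Rightarrow> bool" where
  "weakly_Scheepers_Sakai X \<longleftrightarrow>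
    (\<forall>\<U> :: nat \<Rightarrow> 'a set set. (\<forall>n. open_cover X (\<U> n)) \<longrightarrow>
      (\<exists>\<V> :: nat \<Rightarrow> 'a set set. (\<forall>n. finite (\<V> n) \<and> \<V> n \<subseteq> \<U> n) \<and>
        (\<forall>\<F>. finite \<F> \<and> (\<forall>U\<in>\<F>. openin X U \<and> U \<noteq> {}) \<longrightarrow>
          (\<exists>n. \<forall>U\<in>\<F>. U \<inter> \<Union>(\<V> n) \<noteq> {}))))"

definition weakly_Scheepers_Kocinac :: "'a topology \<Rightarrow> bool" where
  "weakly_Scheepers_Kocinac X \<longleftrightarrow>
    (\<forall>\<U> :: nat \<Rightarrow> 'a set set. (\<forall>n. open_cover X (\<U> n)) \<longrightarrow>
      (\<exists>Y (\<V> :: nat \<Rightarrow> 'a set set). dense_set X Y \<and> (\<forall>n. finite (\<V> n) \<and> \<V> n \<subseteq> \<U> n) \<and>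
        (\<forall>F. finite F \<and> F \<subseteq> Y \<longrightarrow> (\<exists>n. F \<subseteq> \<Union>(\<V> n)))))"

end

theory Submission
  imports Defs
begin

text \<open>Each of the three properties depends on the finite subfamilies \<open>\<V> n\<close> only through
  the sequence of their unions. An assignment \<open>N\<close> yields the cover \<open>{N x | x \<in> X}\<close>, whose
  finite subfamilies are images of finite sets of points; a cover \<open>\<U>\<close> yields an assignment
  by choosing \<open>N x \<in> \<U>\<close> with \<open>x \<in> N x\<close>. In both cases the unions obtained coincide.\<close>

lemma finite_selection_cover_iff_assignment:
  fixes X :: "'a topology" and P :: "(nat \<Rightarrow> 'a set) \<Rightarrow> bool"
  shows "(\<forall>\<U>. (\<forall>n. open_cover X (\<U> n)) \<longrightarrow>
      (\<exists>\<V>. (\<forall>n. finite (\<V> n) \<and> \<V> n \<subseteq> \<U> n) \<and> P (\<lambda>n. \<Union>(\<V> n))))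
    \<longleftrightarrow> (\<forall>N. (\<forall>n. nbhd_assignment X (N n)) \<longrightarrow>
      (\<exists>F. (\<forall>n. finite (F n) \<and> F n \<subseteq> topspace X) \<and> P (\<lambda>n. nbhd_of_set (N n) (F n))))"
    (is "?covers \<longleftrightarrow> ?assignments")
proof (intro iffI allI impI)
  fix N :: "nat \<Rightarrow> 'a \<Rightarrow> 'a set"
  assume covers: ?covers and N: "\<forall>n. nbhd_assignment X (N n)"
  \<comment> \<open>Equality of the union with \<open>topspace X\<close> has two halves:
    \<open>openin_subset\<close> keeps each \<open>N n x\<close> inside the space, and
    \<open>x \<in> N n x\<close> gives covering.\<close>
  have "\<forall>n. open_cover X (N n ` topspace X)"
    using N openin_subset unfolding open_cover_def nbhd_assignment_def by fast
  with covers obtain \<V> where \<V>: "\<And>n. finite (\<V> n) \<and> \<V> n \<subseteq> N n ` topspace X"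
    and P: "P (\<lambda>n. \<Union>(\<V> n))"
    by (elim allE[of _ "\<lambda>n. N n ` topspace X"]) blast
  \<comment> \<open>The map \<open>N n\<close> need not be injective, so the full preimage of
    \<open>\<V> n\<close> may be infinite; one point per member of \<open>\<V> n\<close>
    suffices.\<close>
  have "\<forall>n. \<exists>F. F \<subseteq> topspace X \<and> finite F \<and> \<V> n = N n ` F"
    using \<V> finite_subset_image by metis
  then obtain F where F: "\<And>n. F n \<subseteq> topspace X \<and> finite (F n) \<and> \<V> n = N n ` F n"
    by metis
  \<comment> \<open>Since \<open>P\<close> is an arbitrary predicate on sequences, the two sequences
    must agree as functions before one can replace the other.\<close>
  then have eq: "(\<lambda>n. \<Union>(\<V> n)) = (\<lambda>n. nbhd_of_set (N n) (F n))"
    by (simp add: nbhd_of_set_def)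
  from P have "P (\<lambda>n. nbhd_of_set (N n) (F n))"
    by (simp only: eq)
  with F show "\<exists>F. (\<forall>n. finite (F n) \<and> F n \<subseteq> topspace X) \<and> P (\<lambda>n. nbhd_of_set (N n) (F n))"
    by blast
next
  fix \<U> :: "nat \<Rightarrow> 'a set set"
  assume assignments: ?assignments and \<U>: "\<forall>n. open_cover X (\<U> n)"
  \<comment> \<open>The membership premise stands under the existential so that choice gives a total
    \<open>N n\<close>, arbitrary off the space.\<close>
  have "\<forall>n x. \<exists>U. x \<in> topspace X \<longrightarrow> U \<in> \<U> n \<and> x \<in> U"
    using \<U> unfolding open_cover_def by blast
  then obtain N where N: "\<And>n x. x \<in> topspace X \<Longrightarrow> N n x \<in> \<U> n \<and> x \<in> N n x"
    by metis
  then have "\<forall>n. nbhd_assignment X (N n)"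
    using \<U> unfolding open_cover_def nbhd_assignment_def by blast
  with assignments obtain F where F: "\<And>n. finite (F n) \<and> F n \<subseteq> topspace X"
    and P: "P (\<lambda>n. nbhd_of_set (N n) (F n))"
    by blast
  have "\<forall>n. finite (N n ` F n) \<and> N n ` F n \<subseteq> \<U> n"
    using F N by blast
  moreover have "P (\<lambda>n. \<Union>(N n ` F n))"
    using P by (simp only: nbhd_of_set_def)
  ultimately show "\<exists>\<V>. (\<forall>n. finite (\<V> n) \<and> \<V> n \<subseteq> \<U> n) \<and> P (\<lambda>n. \<Union>(\<V> n))"
    by (intro exI[of _ "\<lambda>n. N n ` F n"] conjI)
qed

theorem theorem3p1:
  fixes X :: "'a topology"
  shows "(almost_Scheepers X \<longleftrightarrow>
      (\<forall>N :: nat \<Rightarrow> 'a \<Rightarrow> 'a set. (\<forall>n. nbhd_assignment X (N n)) \<longrightarrow>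
        (\<exists>F :: nat \<Rightarrow> 'a set. (\<forall>n. finite (F n) \<and> F n \<subseteq> topspace X) \<and>
          (\<forall>G. finite G \<and> G \<subseteq> topspace X \<longrightarrow>
            (\<exists>n. G \<subseteq> X closure_of (nbhd_of_set (N n) (F n)))))))
    \<and> (weakly_Scheepers_Sakai X \<longleftrightarrow>
      (\<forall>N :: nat \<Rightarrow> 'a \<Rightarrow> 'a set. (\<forall>n. nbhd_assignment X (N n)) \<longrightarrow>
        (\<exists>F :: nat \<Rightarrow> 'a set. (\<forall>n. finite (F n) \<and> F n \<subseteq> topspace X) \<and>
          (\<forall>\<F>. finite \<F> \<and> (\<forall>U\<in>\<F>. openin X U \<and> U \<noteq> {}) \<longrightarrow>
            (\<exists>n. \<forall>U\<in>\<F>. U \<inter> nbhd_of_set (N n) (F n) \<noteq> {})))))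
    \<and> (weakly_Scheepers_Kocinac X \<longleftrightarrow>
      (\<forall>N :: nat \<Rightarrow> 'a \<Rightarrow> 'a set. (\<forall>n. nbhd_assignment X (N n)) \<longrightarrow>
        (\<exists>(F :: nat \<Rightarrow> 'a set) Y. (\<forall>n. finite (F n) \<and> F n \<subseteq> topspace X) \<and> dense_set X Y \<and>
          (\<forall>G. finite G \<and> G \<subseteq> Y \<longrightarrow> (\<exists>n. G \<subseteq> nbhd_of_set (N n) (F n))))))"
    (is "(_ \<longleftrightarrow> ?almost) \<and> (_ \<longleftrightarrow> ?Sakai) \<and> (_ \<longleftrightarrow> ?Kocinac)")
proof (intro conjI)
  \<comment> \<open>The closure is taken inside \<open>P\<close>, which sees only the unions
    \<open>W n\<close>.\<close>
  show "almost_Scheepers X \<longleftrightarrow> ?almost"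
    unfolding almost_Scheepers_def
    by (rule finite_selection_cover_iff_assignment[where P =
      "\<lambda>W. \<forall>G. finite G \<and> G \<subseteq> topspace X \<longrightarrow> (\<exists>n. G \<subseteq> X closure_of W n)"])
  show "weakly_Scheepers_Sakai X \<longleftrightarrow> ?Sakai"
    unfolding weakly_Scheepers_Sakai_def
    by (rule finite_selection_cover_iff_assignment[where P =
      "\<lambda>W. \<forall>\<F>. finite \<F> \<and> (\<forall>U\<in>\<F>. openin X U \<and> U \<noteq> {}) \<longrightarrow> (\<exists>n. \<forall>U\<in>\<F>. U \<inter> W n \<noteq> {})"])
  \<comment> \<open>The dense set \<open>Y\<close> may depend on the covers and the selection, but
    the selection condition does not mention it. Its quantifier can therefore move inward and become
    part of \<open>P\<close>.\<close>
  have "weakly_Scheepers_Kocinac X \<longleftrightarrow> (\<forall>\<U> :: nat \<Rightarrow> _. (\<forall>n. open_cover X (\<U> n)) \<longrightarrow>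
      (\<exists>\<V>. (\<forall>n. finite (\<V> n) \<and> \<V> n \<subseteq> \<U> n) \<and>
        (\<exists>Y. dense_set X Y \<and> (\<forall>F. finite F \<and> F \<subseteq> Y \<longrightarrow> (\<exists>n. F \<subseteq> \<Union>(\<V> n))))))"
    unfolding weakly_Scheepers_Kocinac_def
    by (subst ex_comm, subst conj_left_commute) (simp only: ex_simps)
  also have "\<dots> \<longleftrightarrow> (\<forall>N :: nat \<Rightarrow> _. (\<forall>n. nbhd_assignment X (N n)) \<longrightarrow>
      (\<exists>F. (\<forall>n. finite (F n) \<and> F n \<subseteq> topspace X) \<and>
        (\<exists>Y. dense_set X Y \<and> (\<forall>G. finite G \<and> G \<subseteq> Y \<longrightarrow> (\<exists>n. G \<subseteq> nbhd_of_set (N n) (F n))))))"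
    by (rule finite_selection_cover_iff_assignment[where P =
      "\<lambda>W. \<exists>Y. dense_set X Y \<and> (\<forall>G. finite G \<and> G \<subseteq> Y \<longrightarrow> (\<exists>n. G \<subseteq> W n))"])
  \<comment> \<open>The finiteness condition on \<open>F\<close> is free of \<open>Y\<close>, so the
    scope of the quantifier over \<open>Y\<close> can be widened past it.\<close>
  also have "\<dots> \<longleftrightarrow> ?Kocinac"
    by (simp only: ex_simps)
  finally show "weakly_Scheepers_Kocinac X \<longleftrightarrow> ?Kocinac" .
qed

end
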